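(* Let $n\ge3$ be an odd integer, $d,k\ge1$ integers, and $E\subset\mathbb{Z}_n^d$. Suppose that \[ |E|\gg\frac{\sqrt{\tau(n)}\,n^{d+\frac{k-1}{2}}}{\gamma(n)^{(d-1)/2}}. \] Then \[ \frac{1}{|E|^k}\sum_{y^1,\dots,y^k\in E}\left|\Pi_{y^1,\dots,y^k}(E)\right|\gg n^k. \]
   Context: For $x,y\in\mathbb{Z}_n^d$, $x\cdot y=x_1y_1+\dots+x_dy_d$. For $y^1,\dots,y^k\in\mathbb{Z}_n^d$, the dot-product $k$-star set is $\Pi_{y^1,\dots,y^k}(E)=\{(x\cdot y^1,\dots,x\cdot y^k)\in\mathbb{Z}_n^k : x\in E\}$. $\gamma(n)$ is the smallest prime divisor of $n$, $\tau(n)$ the number of divisors of $n$. $X\gg Y$ means $X\ge CY$ for a constant $C>0$ independent of $n$ and $E$ (possibly depending on $d,k$); a hypothesis $|E|\gg Y$ means $|E|\ge CY$ for a suitable sufficiently large such constant. *)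

theory Defs
  imports Complex_Main "HOL-Library.FuncSet" "HOL-Number_Theory.Residues"
begin

text \<open>
  Since the modulus \<open>n\<close> varies inside the statement (the implied constants must not depend
  on it), vectors over the ring of integers modulo \<open>n\<close> are extensional functions on
  \<open>{..<d}\<close> with values in the carrier \<open>{0..n - 1}\<close> of the library ring \<open>residue_ring n\<close>.
  Coordinates are indexed from \<open>0\<close>.
\<close>

definition zn_vec :: "nat \<Rightarrow> nat \<Rightarrow> (nat \<Rightarrow> int) set" where
  "zn_vec n d = {..<d} \<rightarrow>\<^sub>E carrier (residue_ring (int n))"

definition zn_dot :: "nat \<Rightarrow> nat \<Rightarrow> (nat \<Rightarrow> int) \<Rightarrow> (nat \<Rightarrow> int) \<Rightarrow> int" where
  "zn_dot n d x y =
     finsum (residue_ring (int n)) (\<lambda>i. x i \<otimes>\<^bsub>residue_ring (int n)\<^esub> y i) {..<d}"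

definition star_set ::
    "nat \<Rightarrow> nat \<Rightarrow> nat \<Rightarrow> (nat \<Rightarrow> nat \<Rightarrow> int) \<Rightarrow> (nat \<Rightarrow> int) set \<Rightarrow> (nat \<Rightarrow> int) set" where
  "star_set n d k y E = (\<lambda>x. \<lambda>j\<in>{..<k}. zn_dot n d x (y j)) ` E"

definition least_prime_divisor :: "nat \<Rightarrow> nat" where
  "least_prime_divisor n = (LEAST p. prime p \<and> p dvd n)"

definition num_divisors :: "nat \<Rightarrow> nat" where
  "num_divisors n = card {m. m dvd n}"

lemma zn_vec_eq: "zn_vec n d = {..<d} \<rightarrow>\<^sub>E {0..<int n}"
  by (auto simp: zn_vec_def residue_ring_def PiE_def Pi_def)

lemma zn_dot_eq_mod:
  assumes "n > 1"
  shows "zn_dot n d x y = (\<Sum>i<d. x i * y i) mod int n"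
proof -
  interpret residues "int n" "residue_ring (int n)"
    using assms by unfold_locales auto
  have "finsum (residue_ring (int n)) (\<lambda>i. (x i * y i) mod int n) A
        = (\<Sum>i\<in>A. x i * y i) mod int n" if "finite A" for A :: "nat set"
    using that
  proof (induction A rule: finite_induct)
    case empty
    then show ?case by (simp add: res_zero_eq)
  next
    case (insert a A)
    have "(\<lambda>i. (x i * y i) mod int n) \<in> A \<rightarrow> carrier (residue_ring (int n))"
      using assms by (auto simp: res_carrier_eq)
    then show ?case
      using insert assms
      by (subst finsum_insert) (auto simp: res_carrier_eq res_add_eq mod_simps)
  qed
  then show ?thesis
    unfolding zn_dot_def by (simp add: res_mult_eq)
qed

lemma star_set_subset:
  assumes "n > 1"
  shows "star_set n d k y E \<subseteq> zn_vec n k"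
  using assms by (auto simp: star_set_def zn_vec_eq zn_dot_eq_mod split: if_splits)

end

theory Submission
  imports Defs "HOL-Analysis.Convex"
begin

text \<open>
  For \<open>z\<close> in the whole space let \<open>\<nu>\<^sub>z(t)\<close> be the number of \<open>y \<in> E\<close> with \<open>z \<cdot> y = t\<close>.
  Counting solutions of linear congruences shows that the total variance
  \<open>\<Sum>\<^sub>z \<Sum>\<^sub>t (\<nu>\<^sub>z(t) - |E| / n)\<^sup>2\<close> is at most \<open>n\<^bsup>d-1\<^esup> |E| \<Sum>\<^bsub>0<s<n\<^esub> gcd(s, n)\<^sup>d\<close>,
  which is at most \<open>|E|\<^sup>3 / n\<^sup>k\<close> under the size hypothesis. By Cauchy--Schwarz it suffices to
  bound the number of \<open>(x, x', y\<^sup>1, \<dots>, y\<^sup>k)\<close> with \<open>x \<cdot> y\<^sup>j = x' \<cdot> y\<^sup>j\<close> for all \<open>j\<close>,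
  which is the sum of \<open>\<nu>\<^bsub>x-x'\<^esub>(0)\<^sup>k\<close> over \<open>x, x' \<in> E\<close>. For \<open>k \<ge> 2\<close> each term is controlled
  by the mean and the variance term of \<open>z = x - x'\<close>, \<open>t = 0\<close>. For \<open>k = 1\<close> this loses
  too much, and one rearranges the count as \<open>\<Sum>\<^bsub>y\<in>E\<^esub> \<Sum>\<^sub>t \<nu>\<^sub>y(t)\<^sup>2\<close> instead.
\<close>

section \<open>Additive characters modulo n\<close>

lemma cis_2pi_eq_1_iff:
  fixes b :: int and n :: nat
  assumes "n > 0"
  shows "cis (2 * pi * of_int b / of_nat n) = 1 \<longleftrightarrow> int n dvd b"
proof
  assume "cis (2 * pi * of_int b / of_nat n) = 1"
  then have "cos (2 * pi * of_int b / of_nat n) = 1"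
    by (simp add: complex_eq_iff)
  then obtain m :: int where "2 * pi * of_int b / of_nat n = of_int m * 2 * pi"
    by (auto simp: cos_one_2pi_int)
  then have "real_of_int b = of_int m * of_nat n"
    using assms by (simp add: field_simps)
  then have "real_of_int b = real_of_int (m * int n)"
    by simp
  then have "b = m * int n"
    by (simp only: of_int_eq_iff)
  then show "int n dvd b" by simp
next
  assume "int n dvd b"
  then obtain m where "b = int n * m" by blast
  then have "2 * pi * of_int b / of_nat n = 2 * pi * of_int m"
    using assms by simp
  then show "cis (2 * pi * of_int b / of_nat n) = 1"
    by (simp add: cis_multiple_2pi)
qed

text \<open>Orthogonality of characters: the summands are the powers of a single n-th root of unity
  \<open>w\<close>, so the geometric sum vanishes unless \<open>w = 1\<close>.\<close>

lemma sum_cis_residues: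
  fixes b :: int and n :: nat
  assumes "n > 0"
  shows "(\<Sum>a<n. cis (2 * pi * of_int (int a * b) / of_nat n)) =
    (if int n dvd b then of_nat n else 0)"
proof -
  define w where "w = cis (2 * pi * of_int b / of_nat n)"
  have pow: "cis (2 * pi * of_int (int a * b) / of_nat n) = w ^ a" for a
    by (simp add: w_def Complex.DeMoivre mult_ac)
  \<comment> \<open>This is the criterion for the phase of \<open>int n * b\<close>, which
    \<open>pow\<close> identifies with \<open>w ^ n\<close>.\<close>
  have "w ^ n = 1"
    using assms cis_2pi_eq_1_iff[of n "int n * b"] unfolding pow by simp
  then have "(\<Sum>a<n. w ^ a) = (if w = 1 then of_nat n else 0)"
    by (auto simp: geometric_sum)
  then show ?thesis
    unfolding pow using cis_2pi_eq_1_iff[OF assms, of b] by (simp add: w_def)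
qed

lemma sum_cis_residues_int:
  fixes b :: int and n :: nat
  assumes "n > 0"
  shows "(\<Sum>a\<in>{0..<int n}. cis (2 * pi * of_int (a * b) / of_nat n)) =
    (if int n dvd b then of_nat n else 0)"
proof -
  have "(\<Sum>a\<in>{0..<int n}. cis (2 * pi * of_int (a * b) / of_nat n)) =
      (\<Sum>a<n. cis (2 * pi * of_int (int a * b) / of_nat n))"
    by (rule sum.reindex_bij_witness[of _ int nat]) auto
  then show ?thesis using sum_cis_residues[OF assms] by simp
qed

section \<open>Linear congruences in residue vectors\<close>

lemma finite_zn_vec [simp]: "finite (zn_vec n d)"
  by (simp add: zn_vec_eq finite_PiE)

lemma card_zn_vec: "card (zn_vec n d) = n ^ d"
  by (simp add: zn_vec_eq card_PiE)

lemma cis_sum: "finite A \<Longrightarrow> cis (\<Sum>i\<in>A. f i) = (\<Prod>i\<in>A. cis (f i))"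
  by (induction A rule: finite_induct) (auto simp flip: cis_mult)

text \<open>Both sides evaluate the character sum over all pairs \<open>(s, y)\<close> of the phase \<open>s (z \<cdot> y)\<close>:
  summing over \<open>s\<close> first gives the left side, over \<open>y\<close> first the right side.\<close>

lemma card_orthogonal_eq_card_annihilator:
  fixes z :: "nat \<Rightarrow> int"
  assumes "n > 0"
  shows "n * card {y \<in> zn_vec n d. int n dvd (\<Sum>i<d. z i * y i)} =
    n ^ d * card {s \<in> {..<n}. \<forall>i<d. int n dvd int s * z i}"
proof -
  define e :: "int \<Rightarrow> complex" where "e a = cis (2 * pi * of_int a / of_nat n)" for a
  have e_sum: "e (\<Sum>i\<in>A. f i) = (\<Prod>i\<in>A. e (f i))" if "finite A" for A :: "nat set" and f
    using that by (simp add: e_def sum_distrib_left sum_divide_distrib cis_sum)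
  have "of_nat (n * card {y \<in> zn_vec n d. int n dvd (\<Sum>i<d. z i * y i)}) =
      (\<Sum>y\<in>zn_vec n d. if int n dvd (\<Sum>i<d. z i * y i) then of_nat n else (0::complex))"
    by (simp add: sum.If_cases Int_def)
  also have "\<dots> = (\<Sum>y\<in>zn_vec n d. \<Sum>s<n. e (int s * (\<Sum>i<d. z i * y i)))"
    unfolding e_def using assms by (simp only: sum_cis_residues)
  also have "\<dots> = (\<Sum>s<n. \<Sum>y\<in>zn_vec n d. \<Prod>i<d. e (y i * (int s * z i)))"
    by (subst sum.swap) (simp add: sum_distrib_left mult_ac flip: e_sum)
  \<comment> \<open>The phase is additive in the coordinates, so the sum over vectors factors into
    one complete character sum per coordinate.\<close>
  also have "\<dots> = (\<Sum>s<n. \<Prod>i<d. \<Sum>a\<in>{0..<int n}. e (a * (int s * z i)))"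
    unfolding zn_vec_eq by (subst prod_sum_PiE) auto
  also have "\<dots> = (\<Sum>s<n. \<Prod>i<d. if int n dvd int s * z i then of_nat n else 0)"
    unfolding e_def using assms by (simp only: sum_cis_residues_int)
  also have "\<dots> = (\<Sum>s<n. if \<forall>i<d. int n dvd int s * z i then of_nat n ^ d else 0)"
    by (intro sum.cong refl) (auto intro!: prod_zero)
  also have "\<dots> = of_nat (n ^ d * card {s \<in> {..<n}. \<forall>i<d. int n dvd int s * z i})"
    by (simp add: sum.If_cases Int_def)
  finally show ?thesis by (simp only: of_nat_eq_iff)
qed

text \<open>Dividing the congruence by \<open>g = gcd s n\<close> leaves a coefficient coprime to
  \<open>m = n / g\<close>. Hence \<open>b\<close> is fixed modulo \<open>m\<close>, which leaves at
  most \<open>g\<close> residues modulo \<open>n\<close>.\<close>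

lemma card_solutions_le_gcd:
  fixes a :: int
  assumes "n > 0"
  shows "card {b \<in> {0..<int n}. int n dvd int s * (a - b)} \<le> gcd s n"
proof -
  define g where "g = gcd s n"
  have "gcd s n \<noteq> 0" using assms by simp
  from gcd_coprime_exists[OF this] obtain s' m
    where s': "s = g * s'" and m: "n = g * m" and co: "coprime s' m"
    unfolding g_def by (auto simp: mult.commute)
  have pos: "g > 0" "m > 0"
    using assms m by (auto intro: Nat.gr0I)
  have dvd: "int m dvd a - b" if "int n dvd int s * (a - b)" for b
  proof -
    have "int g * int m dvd int g * (int s' * (a - b))"
      using that by (simp add: s' m mult.assoc)
    then have "int m dvd int s' * (a - b)" using pos by simp
    moreover have "coprime (int m) (int s')" using co by (simp add: coprime_commute)
    ultimately show ?thesis by (simp add: coprime_dvd_mult_right_iff)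
  qed
  \<comment> \<open>All solutions share their remainder modulo \<open>m\<close>, so the quotient
    alone identifies a solution; it takes values in \<open>{0..<int g}\<close>.\<close>
  have "inj_on (\<lambda>b. b div int m) {b \<in> {0..<int n}. int n dvd int s * (a - b)}"
  proof (rule inj_onI)
    fix b c assume b: "b \<in> {b \<in> {0..<int n}. int n dvd int s * (a - b)}"
      and c: "c \<in> {b \<in> {0..<int n}. int n dvd int s * (a - b)}" and eq: "b div int m = c div int m"
    have "int m dvd (a - c) - (a - b)"
      by (rule dvd_diff; rule dvd) (use b c in auto)
    then have "b mod int m = c mod int m" by (simp add: mod_eq_dvd_iff)
    then show "b = c" using eq by (metis div_mult_mod_eq)
  qed
  moreover have "(\<lambda>b. b div int m) ` {b \<in> {0..<int n}. int n dvd int s * (a - b)} \<subseteq> {0..<int g}"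
  proof (rule image_subsetI)
    fix b assume "b \<in> {b \<in> {0..<int n}. int n dvd int s * (a - b)}"
    then have b: "0 \<le> b" "b < int g * int m" by (auto simp: m)
    have "(b div int m) * int m \<le> b"
      using pos div_mult_mod_eq[of b "int m"] pos_mod_sign[of "int m" b] by linarith
    then have "(b div int m) * int m < int g * int m" using b by linarith
    then show "b div int m \<in> {0..<int g}"
      using b pos by (simp add: pos_imp_zdiv_nonneg_iff)
  qed
  ultimately have "card {b \<in> {0..<int n}. int n dvd int s * (a - b)} \<le> card {0..<int g}"
    by (intro card_inj_on_le) auto
  then show ?thesis by (simp add: g_def)
qed

lemma card_vec_solutions_le_gcd_power:
  fixes x :: "nat \<Rightarrow> int"
  assumes "n > 0"
  shows "card {y \<in> zn_vec n d. \<forall>i<d. int n dvd int s * (x i - y i)} \<le> gcd s n ^ d"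
proof -
  have "{y \<in> zn_vec n d. \<forall>i<d. int n dvd int s * (x i - y i)} =
      (\<Pi>\<^sub>E i\<in>{..<d}. {b \<in> {0..<int n}. int n dvd int s * (x i - b)})"
    by (auto simp: zn_vec_eq PiE_def Pi_def)
  also have "card \<dots> \<le> (\<Prod>i<d. gcd s n)"
    unfolding card_PiE[OF finite_lessThan]
    by (intro prod_mono conjI card_solutions_le_gcd[OF assms]) auto
  finally show ?thesis by simp
qed

section \<open>Divisors of n and sums of gcd powers\<close>

lemma prime_least_prime_divisor:
  assumes "n > 1"
  shows "prime (least_prime_divisor n)"
proof -
  have "\<exists>p. prime p \<and> p dvd n" using assms prime_factor_nat[of n] by auto
  from LeastI_ex[OF this] show ?thesis
    unfolding least_prime_divisor_def by auto
qed

text \<open>The cofactor of a proper divisor has a prime factor, which also divides \<open>n\<close>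
  and is therefore at least the least one.\<close>

lemma least_prime_divisor_mult_le:
  assumes "g dvd n" "g < n"
  shows "g * least_prime_divisor n \<le> n"
proof -
  obtain h where h: "n = g * h" using assms by blast
  then have "h \<noteq> 1" using assms by auto
  then obtain p where p: "prime p" "p dvd h" using prime_factor_nat by blast
  then have "least_prime_divisor n \<le> p"
    unfolding least_prime_divisor_def by (intro Least_le) (simp add: h)
  also have "p \<le> h" using p assms h by (intro dvd_imp_le) (auto intro: Nat.gr0I)
  finally show ?thesis by (simp add: h)
qed

text \<open>Only multiples of \<open>g\<close> below \<open>n\<close> can occur, and there are
  \<open>n div g\<close> of them.\<close>

lemma card_gcd_eq_le:
  assumes "g > 0" "g dvd n"
  shows "card {s \<in> {1..<n}. gcd s n = g} \<le> n div g"
proof -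
  have "{s \<in> {1..<n}. gcd s n = g} \<subseteq> (*) g ` {..<n div g}"
  proof
    fix s assume s: "s \<in> {s \<in> {1..<n}. gcd s n = g}"
    then have "g dvd s" by auto
    then obtain t where t: "s = g * t" by blast
    have "g * t < g * (n div g)" using s t assms by simp
    then have "t < n div g" by simp
    then show "s \<in> (*) g ` {..<n div g}" using t by blast
  qed
  from surj_card_le[OF _ this] show ?thesis by simp
qed

text \<open>The sum is grouped by the value \<open>g\<close> of the gcd. At most
  \<open>n / g\<close> residues share it, so each group contributes at most n g^(d-1). Leaving out
  \<open>s = 0\<close> makes every \<open>g\<close> a proper divisor, which is where the saving
  \<open>g \<le> n / \<gamma>\<close> comes from; the number of groups is at most the number of
  divisors.\<close>

lemma sum_gcd_power_le:
  assumes "n > 1" "d \<ge> 1"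
  shows "(\<Sum>s\<in>{1..<n}. real (gcd s n) ^ d) \<le>
    real n * real (num_divisors n) * (real n / real (least_prime_divisor n)) ^ (d - 1)"
proof -
  define D where "D = {g. g dvd n \<and> g < n}"
  define \<gamma> where "\<gamma> = least_prime_divisor n"
  have fin: "finite {g. g dvd n}" using assms by simp
  have \<gamma>: "\<gamma> > 0" using prime_least_prime_divisor[OF assms(1)] by (simp add: \<gamma>_def prime_gt_0_nat)
  have finD: "finite D" and cardD: "card D \<le> num_divisors n"
    using fin unfolding D_def num_divisors_def by (auto intro!: card_mono)
  have "(\<lambda>s. gcd s n) ` {1..<n} \<subseteq> D"
  proof (rule image_subsetI)
    fix s assume "s \<in> {1..<n}"
    then have "gcd s n \<le> s" "s < n" by (auto intro: gcd_le1_nat)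
    then show "gcd s n \<in> D" unfolding D_def by simp
  qed
  then have "(\<Sum>s\<in>{1..<n}. real (gcd s n) ^ d) =
      (\<Sum>g\<in>D. \<Sum>s | s \<in> {1..<n} \<and> gcd s n = g. real (gcd s n) ^ d)"
    using finD by (intro sum.group[symmetric]) auto
  also have "\<dots> \<le> (\<Sum>g\<in>D. real n * (real n / \<gamma>) ^ (d - 1))"
  proof (intro sum_mono)
    fix g assume g: "g \<in> D"
    then have g0: "g > 0" using assms by (auto simp: D_def intro: Nat.gr0I)
    have "(\<Sum>s | s \<in> {1..<n} \<and> gcd s n = g. real (gcd s n) ^ d) =
        card {s \<in> {1..<n}. gcd s n = g} * real g ^ d" by simp
    also have "\<dots> \<le> real (n div g) * real g ^ d"
      using card_gcd_eq_le[OF g0, of n] g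
      by (intro mult_right_mono) (simp_all add: D_def)
    also have "\<dots> = real n * real g ^ (d - 1)"
      using g g0 assms by (simp add: D_def real_of_nat_div power_eq_if)
    also have "\<dots> \<le> real n * (real n / \<gamma>) ^ (d - 1)"
    proof (intro mult_left_mono power_mono)
      have "g * \<gamma> \<le> n" using least_prime_divisor_mult_le g by (auto simp: D_def \<gamma>_def)
      then have "real g * real \<gamma> \<le> real n" by (metis of_nat_le_iff of_nat_mult)
      then show "real g \<le> real n / \<gamma>" using \<gamma> by (simp add: field_simps)
    qed auto
    finally show "(\<Sum>s | s \<in> {1..<n} \<and> gcd s n = g. real (gcd s n) ^ d)
      \<le> real n * (real n / \<gamma>) ^ (d - 1)" .
  qed
  also have "\<dots> = card D * (real n * (real n / \<gamma>) ^ (d - 1))" by simp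
  also have "\<dots> \<le> num_divisors n * (real n * (real n / \<gamma>) ^ (d - 1))"
    using cardD by (intro mult_right_mono) auto
  finally show ?thesis by (simp add: \<gamma>_def mult_ac)
qed

section \<open>Fibres, collisions and double counting\<close>

lemma sum_card_fibres:
  assumes "finite A" "finite B" "f ` A \<subseteq> B"
  shows "(\<Sum>t\<in>B. card {x \<in> A. f x = t}) = card A"
  using sum.group[OF assms, of "\<lambda>_. 1::nat"] by simp

lemma sum_card_fibres_power2:
  assumes "finite A" "finite B" "f ` A \<subseteq> B"
  shows "(\<Sum>t\<in>B. (card {x \<in> A. f x = t})\<^sup>2) = (\<Sum>x\<in>A. card {x' \<in> A. f x = f x'})"
proof -
  have "(\<Sum>x\<in>A. card {x' \<in> A. f x = f x'}) =
      (\<Sum>t\<in>B. \<Sum>x | x \<in> A \<and> f x = t. card {x' \<in> A. f x = f x'})"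
    using assms by (intro sum.group[symmetric])
  also have "\<dots> = (\<Sum>t\<in>B. \<Sum>x | x \<in> A \<and> f x = t. card {x' \<in> A. f x' = t})"
    by (intro sum.cong refl arg_cong[where f = card]) auto
  finally show ?thesis by (simp add: power2_eq_square)
qed

text \<open>Cauchy-Schwarz for the fibre sizes over the image: they add up to \<open>card A\<close>,
  and their squares count colliding pairs. Few collisions thus force a large image.\<close>

lemma card_power2_le_card_image_mult_collisions:
  assumes "finite A"
  shows "(real (card A))\<^sup>2 \<le> real (card (f ` A)) * real (\<Sum>x\<in>A. card {x' \<in> A. f x = f x'})"
proof -
  have "(real (card A))\<^sup>2 = (\<Sum>t\<in>f ` A. 1 * real (card {x \<in> A. f x = t}))\<^sup>2"
    using sum_card_fibres[of A "f ` A" f] assms by (simp flip: of_nat_sum)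
  also have "\<dots> \<le> (\<Sum>t\<in>f ` A. 1\<^sup>2) * (\<Sum>t\<in>f ` A. (real (card {x \<in> A. f x = t}))\<^sup>2)"
    by (rule Cauchy_Schwarz_ineq_sum)
  also have "(\<Sum>t\<in>f ` A. (real (card {x \<in> A. f x = t}))\<^sup>2) =
      real (\<Sum>x\<in>A. card {x' \<in> A. f x = f x'})"
    using sum_card_fibres_power2[of A "f ` A" f] assms by (simp flip: of_nat_sum of_nat_power)
  finally show ?thesis by simp
qed

lemma sum_card_swap:
  assumes "finite A" "finite B"
  shows "(\<Sum>a\<in>A. card {b \<in> B. P a b}) = (\<Sum>b\<in>B. card {a \<in> A. P a b})"
proof -
  have "(\<Sum>a\<in>A. card {b \<in> B. P a b}) = (\<Sum>a\<in>A. \<Sum>b\<in>B. of_bool (P a b))"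
    using assms by (simp add: Int_def)
  also have "\<dots> = (\<Sum>b\<in>B. \<Sum>a\<in>A. of_bool (P a b))" by (rule sum.swap)
  finally show ?thesis using assms by (simp add: Int_def)
qed

section \<open>Variance of the dot-product counts\<close>

definition dot_count :: "nat \<Rightarrow> nat \<Rightarrow> (nat \<Rightarrow> int) set \<Rightarrow> (nat \<Rightarrow> int) \<Rightarrow> int \<Rightarrow> nat" where
  "dot_count n d E z t = card {y \<in> E. (\<Sum>i<d. z i * y i) mod int n = t}"

text \<open>For finite \<open>E\<close> and positive \<open>n\<close> this is \<open>n\<close> times
  the variance of the counts for uniformly distributed \<open>t\<close>, since the counts add up to
  \<open>card E\<close>.\<close>

definition dot_discrepancy :: "nat \<Rightarrow> nat \<Rightarrow> (nat \<Rightarrow> int) set \<Rightarrow> (nat \<Rightarrow> int) \<Rightarrow> real" where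
  "dot_discrepancy n d E z =
    (\<Sum>t\<in>{0..<int n}. (real (dot_count n d E z t) - real (card E) / real n)\<^sup>2)"

lemma dot_discrepancy_nonneg: "dot_discrepancy n d E z \<ge> 0"
  unfolding dot_discrepancy_def by (intro sum_nonneg) simp

text \<open>The square is expanded: the first moment of the counts is \<open>card E\<close>, and the
  second counts pairs in \<open>E\<close> with equal dot product against \<open>z\<close>.\<close>

lemma dot_discrepancy_eq:
  assumes "n > 0" "finite E"
  shows "dot_discrepancy n d E z =
    real (\<Sum>x\<in>E. card {x' \<in> E. int n dvd (\<Sum>i<d. (x i - x' i) * z i)}) -
      (real (card E))\<^sup>2 / real n"
proof -
  define f where "f y = (\<Sum>i<d. z i * y i) mod int n" for y
  define a where "a = real (card E) / real n"
  have sub: "f ` E \<subseteq> {0..<int n}" using assms by (auto simp: f_def)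
  have sum1: "(\<Sum>t\<in>{0..<int n}. real (dot_count n d E z t)) = real (card E)"
    using sum_card_fibres[OF assms(2) _ sub]
    unfolding dot_count_def f_def by (simp flip: of_nat_sum)
  have "(\<Sum>t\<in>{0..<int n}. (real (dot_count n d E z t))\<^sup>2) =
      real (\<Sum>x\<in>E. card {x' \<in> E. f x = f x'})"
    using sum_card_fibres_power2[OF assms(2) _ sub]
    unfolding dot_count_def f_def by (simp flip: of_nat_sum of_nat_power)
  moreover have "f x = f x' \<longleftrightarrow> int n dvd (\<Sum>i<d. (x i - x' i) * z i)" for x x'
    unfolding f_def mod_eq_dvd_iff by (simp add: algebra_simps sum_subtractf)
  ultimately have sum2: "(\<Sum>t\<in>{0..<int n}. (real (dot_count n d E z t))\<^sup>2) =
    real (\<Sum>x\<in>E. card {x' \<in> E. int n dvd (\<Sum>i<d. (x i - x' i) * z i)})" by simp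
  have "dot_discrepancy n d E z = (\<Sum>t\<in>{0..<int n}.
      (real (dot_count n d E z t))\<^sup>2 - 2 * a * real (dot_count n d E z t) + a\<^sup>2)"
    unfolding dot_discrepancy_def a_def
    by (intro sum.cong refl) (simp add: power2_diff)
  also have "\<dots> = (\<Sum>t\<in>{0..<int n}. (real (dot_count n d E z t))\<^sup>2)
      - 2 * a * real (card E) + real n * a\<^sup>2"
    by (simp add: sum.distrib sum_subtractf sum1 flip: sum_distrib_left)
  finally show ?thesis
    using assms unfolding sum2 by (simp add: a_def power2_eq_square field_simps)
qed

text \<open>For each pair \<open>x\<close>, \<open>x'\<close> the number of \<open>z\<close>
  orthogonal to the difference is converted into a number of annihilating scalars \<open>s\<close>.
  The scalar 0 yields exactly the mean term, which cancels; each other \<open>s\<close> admits at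
  most gcd(s, n)^d choices of \<open>x'\<close> for a given \<open>x\<close>.\<close>

lemma sum_dot_discrepancy_le:
  assumes n: "n > 0" and E: "E \<subseteq> zn_vec n d"
  shows "real n * (\<Sum>z\<in>zn_vec n d. dot_discrepancy n d E z) \<le>
    real n ^ d * real (card E) * (\<Sum>s\<in>{1..<n}. real (gcd s n) ^ d)"
proof -
  have fin: "finite E" by (rule finite_subset[OF E finite_zn_vec])
  define Q where "Q x x' z \<longleftrightarrow> int n dvd (\<Sum>i<d. (x i - x' i) * z i)"
    for x x' z :: "nat \<Rightarrow> int"
  define A where "A x x' s \<longleftrightarrow> (\<forall>i<d. int n dvd int s * (x i - x' i))"
    for x x' :: "nat \<Rightarrow> int" and s
  \<comment> \<open>The scalar 0 annihilates every difference; it is separated here because it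
    produces the term n^d |E|^2.\<close>
  have split: "card {s \<in> {..<n}. A x x' s} = 1 + card {s \<in> {1..<n}. A x x' s}" for x x'
  proof -
    have "{s \<in> {..<n}. A x x' s} = insert 0 {s \<in> {1..<n}. A x x' s}"
      using n by (auto simp: A_def)
    moreover have "finite {s \<in> {1..<n}. A x x' s}" by (rule finite_Collect_conjI) simp
    ultimately show ?thesis by (simp only: card_insert_disjoint) simp
  qed
  have "n * (\<Sum>z\<in>zn_vec n d. \<Sum>x\<in>E. card {x' \<in> E. Q x x' z}) =
      (\<Sum>x\<in>E. \<Sum>x'\<in>E. n * card {z \<in> zn_vec n d. Q x x' z})"
    unfolding sum_distrib_left[symmetric]
    by (subst sum.swap) (simp add: sum_card_swap[OF finite_zn_vec fin])
  also have "\<dots> = (\<Sum>x\<in>E. \<Sum>x'\<in>E. n ^ d * card {s \<in> {..<n}. A x x' s})"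
    unfolding Q_def A_def using n by (simp only: card_orthogonal_eq_card_annihilator)
  also have "\<dots> = n ^ d * (card E ^ 2 + (\<Sum>x\<in>E. \<Sum>x'\<in>E. card {s \<in> {1..<n}. A x x' s}))"
    unfolding split
    by (simp add: sum.distrib power2_eq_square distrib_left mult_ac flip: sum_distrib_left)
  also have "(\<Sum>x\<in>E. \<Sum>x'\<in>E. card {s \<in> {1..<n}. A x x' s}) =
      (\<Sum>x\<in>E. \<Sum>s\<in>{1..<n}. card {x' \<in> E. A x x' s})"
    by (simp only: sum_card_swap[OF fin finite_atLeastLessThan])
  also have "\<dots> \<le> (\<Sum>x\<in>E. \<Sum>s\<in>{1..<n}. gcd s n ^ d)"
  proof (intro sum_mono)
    fix x s
    have "card {x' \<in> E. A x x' s} \<le> card {x' \<in> zn_vec n d. A x x' s}"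
      using E by (intro card_mono) auto
    also have "\<dots> \<le> gcd s n ^ d"
      unfolding A_def by (rule card_vec_solutions_le_gcd_power[OF n])
    finally show "card {x' \<in> E. A x x' s} \<le> gcd s n ^ d" .
  qed
  also have "\<dots> = card E * (\<Sum>s\<in>{1..<n}. gcd s n ^ d)" by simp
  finally have "n * (\<Sum>z\<in>zn_vec n d. \<Sum>x\<in>E. card {x' \<in> E. Q x x' z}) \<le>
      n ^ d * (card E ^ 2 + card E * (\<Sum>s\<in>{1..<n}. gcd s n ^ d))" by simp
  then have "real (n * (\<Sum>z\<in>zn_vec n d. \<Sum>x\<in>E. card {x' \<in> E. Q x x' z})) \<le>
      real (n ^ d * (card E ^ 2 + card E * (\<Sum>s\<in>{1..<n}. gcd s n ^ d)))"
    by (simp only: of_nat_le_iff)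
  \<comment> \<open>The subtracted squares of the mean add up over all n^d vectors to the
    contribution of \<open>s = 0\<close>.\<close>
  moreover have "real n * (\<Sum>z\<in>zn_vec n d. dot_discrepancy n d E z) =
      real (n * (\<Sum>z\<in>zn_vec n d. \<Sum>x\<in>E. card {x' \<in> E. Q x x' z})) -
        real n ^ d * (real (card E))\<^sup>2"
    unfolding dot_discrepancy_eq[OF n fin] Q_def using n
    by (simp add: sum_subtractf card_zn_vec right_diff_distrib)
  ultimately show ?thesis by (simp add: algebra_simps)
qed

text \<open>The vectors \<open>x - x'\<close>, reduced modulo \<open>n\<close>, are pairwise distinct elements of the whole space,
  so positivity allows the sum over \<open>x\<close> to be extended to all vectors.\<close>

lemma sum_coincidence_deviation_le:
  assumes n: "n > 0" and E: "E \<subseteq> zn_vec n d"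
  shows "(\<Sum>x\<in>E. (real (card {y \<in> E. int n dvd (\<Sum>i<d. (x i - x' i) * y i)})
      - real (card E) / real n)\<^sup>2) \<le> (\<Sum>z\<in>zn_vec n d. dot_discrepancy n d E z)"
proof -
  define h where "h x = (\<lambda>i\<in>{..<d}. (x i - x' i) mod int n)" for x
  have inj: "inj_on h E"
  proof (rule inj_onI)
    fix x w assume x: "x \<in> E" and w: "w \<in> E" and eq: "h x = h w"
    show "x = w"
    proof
      fix i
      show "x i = w i"
      proof (cases "i < d")
        case True
        then have "(x i - x' i) mod int n = (w i - x' i) mod int n"
          using fun_cong[OF eq, of i] by (simp add: h_def)
        then have "int n dvd x i - w i" unfolding mod_eq_dvd_iff by simp
        then have "x i mod int n = w i mod int n" unfolding mod_eq_dvd_iff .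
        moreover have "x i \<in> {0..<int n}" "w i \<in> {0..<int n}"
          using PiE_mem[OF subsetD[OF E x, unfolded zn_vec_eq]]
            PiE_mem[OF subsetD[OF E w, unfolded zn_vec_eq]] True by auto
        ultimately show ?thesis by simp
      next
        case False
        then have "x i = undefined" "w i = undefined"
          using PiE_arb[OF subsetD[OF E x, unfolded zn_vec_eq]]
            PiE_arb[OF subsetD[OF E w, unfolded zn_vec_eq]] by auto
        then show ?thesis by simp
      qed
    qed
  qed
  have sub: "h ` E \<subseteq> zn_vec n d"
    using n by (auto simp: h_def zn_vec_eq split: if_splits)
  have "(\<Sum>i<d. h x i * y i) mod int n = (\<Sum>i<d. (x i - x' i) * y i) mod int n" for x y
  proof -
    have "(\<Sum>i<d. h x i * y i) mod int n = (\<Sum>i<d. h x i * y i mod int n) mod int n"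
      by (rule mod_sum_eq[symmetric])
    also have "(\<Sum>i<d. h x i * y i mod int n) = (\<Sum>i<d. (x i - x' i) * y i mod int n)"
      by (intro sum.cong refl) (simp add: h_def mod_mult_left_eq)
    also have "\<dots> mod int n = (\<Sum>i<d. (x i - x' i) * y i) mod int n"
      by (rule mod_sum_eq)
    finally show ?thesis .
  qed
  then have "(\<Sum>x\<in>E. (real (card {y \<in> E. int n dvd (\<Sum>i<d. (x i - x' i) * y i)})
      - real (card E) / real n)\<^sup>2) =
      (\<Sum>x\<in>E. (real (dot_count n d E (h x) 0) - real (card E) / real n)\<^sup>2)"
    by (simp only: dot_count_def dvd_eq_mod_eq_0)
  also have "\<dots> \<le> (\<Sum>x\<in>E. dot_discrepancy n d E (h x))"
  proof (rule sum_mono)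
    fix x
    \<comment> \<open>The left side is the summand \<open>t = 0\<close> of a sum of squares.\<close>
    show "(real (dot_count n d E (h x) 0) - real (card E) / real n)\<^sup>2 \<le> dot_discrepancy n d E (h x)"
      unfolding dot_discrepancy_def using n
      by (intro member_le_sum[where i = 0 and
            f = "\<lambda>t. (real (dot_count n d E (h x) t) - real (card E) / real n)\<^sup>2"]) auto
  qed
  also have "\<dots> = (\<Sum>z\<in>h ` E. dot_discrepancy n d E z)"
    by (simp add: sum.reindex[OF inj])
  also have "\<dots> \<le> (\<Sum>z\<in>zn_vec n d. dot_discrepancy n d E z)"
    using sub by (intro sum_mono2) (auto simp: dot_discrepancy_nonneg)
  finally show ?thesis .
qed

section \<open>From star sets to collision counts\<close>

text \<open>The collision inequality is applied once on the product of E^k and E rather than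
  separately for each \<open>y\<close>. For fixed \<open>x\<close>, \<open>x'\<close> the conditions
  on the k entries of \<open>y\<close> are independent and identical, hence the k-th power.\<close>

lemma card_power_le_star_sets_mult_collisions:
  assumes n: "n > 1" and fin: "finite E"
  shows "(real (card E) ^ (k + 1))\<^sup>2 \<le>
    (\<Sum>y\<in>{..<k} \<rightarrow>\<^sub>E E. real (card (star_set n d k y E))) *
    (\<Sum>x\<in>E. \<Sum>x'\<in>E. real (card {y \<in> E. int n dvd (\<Sum>i<d. (x i - x' i) * y i)}) ^ k)"
proof -
  define P where "P = {..<k} \<rightarrow>\<^sub>E E"
  define g where "g x y = (\<lambda>j\<in>{..<k}. zn_dot n d x (y j))" for x y
  \<comment> \<open>Keeping \<open>y\<close> in the value makes the image a disjoint union of star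
    sets and restricts collisions to equal \<open>y\<close>.\<close>
  define f where "f = (\<lambda>(y, x). (y, g x y))"
  define N where "N x x' = {y \<in> E. int n dvd (\<Sum>i<d. (x i - x' i) * y i)}"
    for x x' :: "nat \<Rightarrow> int"
  have finP: "finite P" and cardP: "card P = card E ^ k"
    using fin by (simp_all add: P_def finite_PiE card_PiE)
  have "f ` (P \<times> E) = Sigma P (\<lambda>y. star_set n d k y E)"
    by (auto simp: f_def g_def star_set_def)
  moreover have "finite (star_set n d k y E)" for y
    using fin by (simp add: star_set_def)
  ultimately have image: "real (card (f ` (P \<times> E))) = (\<Sum>y\<in>P. real (card (star_set n d k y E)))"
    using finP by (simp add: card_SigmaI)
  have coll: "{y \<in> P. g x y = g x' y} = {..<k} \<rightarrow>\<^sub>E N x x'" for x x'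
  proof -
    have "zn_dot n d x w = zn_dot n d x' w \<longleftrightarrow> int n dvd (\<Sum>i<d. (x i - x' i) * w i)" for w
      using n by (simp add: zn_dot_eq_mod mod_eq_dvd_iff left_diff_distrib sum_subtractf)
    then have "g x y = g x' y \<longleftrightarrow> (\<forall>j<k. int n dvd (\<Sum>i<d. (x i - x' i) * y j i))" for y
      by (auto simp: g_def fun_eq_iff restrict_def)
    then show ?thesis by (auto simp: P_def N_def PiE_def Pi_def)
  qed
  have "(\<Sum>p\<in>P \<times> E. card {p' \<in> P \<times> E. f p = f p'}) =
      (\<Sum>y\<in>P. \<Sum>x\<in>E. card {x' \<in> E. g x y = g x' y})"
    unfolding sum.cartesian_product
  proof (intro sum.cong refl, clarify)
    fix y x assume "y \<in> P"
    then have "{p' \<in> P \<times> E. f (y, x) = f p'} = Pair y ` {x' \<in> E. g x y = g x' y}"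
      by (auto simp: f_def)
    then show "card {p' \<in> P \<times> E. f (y, x) = f p'} = card {x' \<in> E. g x y = g x' y}"
      by (simp add: card_image inj_on_def)
  qed
  also have "\<dots> = (\<Sum>x\<in>E. \<Sum>x'\<in>E. card {y \<in> P. g x y = g x' y})"
    by (subst sum.swap) (simp only: sum_card_swap[OF finP fin])
  also have "\<dots> = (\<Sum>x\<in>E. \<Sum>x'\<in>E. card (N x x') ^ k)"
    unfolding coll by (simp add: card_PiE)
  finally have "real (\<Sum>p\<in>P \<times> E. card {p' \<in> P \<times> E. f p = f p'}) =
      (\<Sum>x\<in>E. \<Sum>x'\<in>E. real (card (N x x')) ^ k)" by simp
  then show ?thesis
    using card_power2_le_card_image_mult_collisions[of "P \<times> E" f] finP fin
    unfolding image P_def[symmetric] N_def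
    by (simp add: card_cartesian_product cardP mult.commute)
qed

text \<open>Either \<open>N\<close> is at most twice the mean \<open>a\<close>, or
  \<open>N < 2 * (N - a)\<close>. In the second case two factors of \<open>N\<close> are paid for by
  the squared deviation and the other k - 2 by the trivial bound \<open>b\<close>.\<close>

lemma power_le_double_mean_plus_deviation:
  fixes N a b :: real
  assumes "0 \<le> N" "N \<le> b" "0 \<le> a" "k \<ge> 2"
  shows "N ^ k \<le> (2 * a) ^ k + 4 * b ^ (k - 2) * (N - a)\<^sup>2"
proof (cases "N \<le> 2 * a")
  case True
  then have "N ^ k \<le> (2 * a) ^ k" using assms by (intro power_mono)
  moreover have "0 \<le> 4 * b ^ (k - 2) * (N - a)\<^sup>2" using assms by simp
  ultimately show ?thesis by linarith
next
  case False
  have "N\<^sup>2 \<le> (2 * (N - a))\<^sup>2" using False assms by (intro power_mono) auto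
  also have "\<dots> = 4 * (N - a)\<^sup>2" by (simp only: power_mult_distrib) simp
  finally have "N ^ (k - 2) * N\<^sup>2 \<le> b ^ (k - 2) * (4 * (N - a)\<^sup>2)"
    using assms by (intro mult_mono power_mono) auto
  moreover have "N ^ k = N ^ (k - 2) * N\<^sup>2"
    using power_add[of N "k - 2" 2] by (simp only: le_add_diff_inverse2[OF assms(4)])
  moreover have "0 \<le> (2 * a) ^ k" using assms by simp
  ultimately show ?thesis by (simp add: mult_ac)
qed

text \<open>Hypothesis \<open>D\<close> is calibrated so that the deviations cost no more, up to a
  constant, than the main term |E|^(k+2) / n^k that equidistribution would give.\<close>

lemma collisions_le:
  assumes n: "n > 0" and E: "E \<subseteq> zn_vec n d" and k: "k \<ge> 1"
    and D: "(\<Sum>z\<in>zn_vec n d. dot_discrepancy n d E z) \<le> real (card E) ^ 3 / real n ^ k"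
  shows "(\<Sum>x\<in>E. \<Sum>x'\<in>E. real (card {y \<in> E. int n dvd (\<Sum>i<d. (x i - x' i) * y i)}) ^ k)
    \<le> (2 ^ k + 4) * real (card E) ^ (k + 2) / real n ^ k"
proof (cases "k = 1")
  case True
  define Q where "Q x x' z \<longleftrightarrow> int n dvd (\<Sum>i<d. (x i - x' i) * z i)"
    for x x' z :: "nat \<Rightarrow> int"
  have fin: "finite E" by (rule finite_subset[OF E finite_zn_vec])
  have "(\<Sum>x\<in>E. \<Sum>x'\<in>E. card {y \<in> E. Q x x' y}) = (\<Sum>x\<in>E. \<Sum>y\<in>E. card {x' \<in> E. Q x x' y})"
    by (intro sum.cong refl sum_card_swap fin)
  also have "\<dots> = (\<Sum>y\<in>E. \<Sum>x\<in>E. card {x' \<in> E. Q x x' y})"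
    by (rule sum.swap)
  finally have "(\<Sum>x\<in>E. \<Sum>x'\<in>E. real (card {y \<in> E. Q x x' y})) =
      (\<Sum>y\<in>E. real (\<Sum>x\<in>E. card {x' \<in> E. Q x x' y}))"
    by (simp flip: of_nat_sum)
  also have "\<dots> = (\<Sum>y\<in>E. dot_discrepancy n d E y + (real (card E))\<^sup>2 / real n)"
    unfolding dot_discrepancy_eq[OF n fin] Q_def by simp
  also have "\<dots> = (\<Sum>y\<in>E. dot_discrepancy n d E y) + real (card E) ^ 3 / real n"
    by (simp only: sum.distrib sum_constant power3_eq_cube power2_eq_square
        times_divide_eq_right mult.assoc)
  also have "(\<Sum>y\<in>E. dot_discrepancy n d E y) \<le> (\<Sum>z\<in>zn_vec n d. dot_discrepancy n d E z)"
    using E by (intro sum_mono2) (auto simp: dot_discrepancy_nonneg)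
  also have "\<dots> \<le> real (card E) ^ 3 / real n" using D True by simp
  \<comment> \<open>The mean and the variance contribute one unit each; 6 is the value of
    \<open>2 ^ k + 4\<close> at \<open>k = 1\<close>.\<close>
  also have "real (card E) ^ 3 / real n + real (card E) ^ 3 / real n \<le>
      6 * real (card E) ^ 3 / real n"
    by (simp add: divide_right_mono flip: add_divide_distrib)
  finally show ?thesis using True by (simp add: Q_def power3_eq_cube)
next
  case False
  define e where "e = real (card E)"
  define a where "a = e / real n"
  define N where "N x x' = real (card {y \<in> E. int n dvd (\<Sum>i<d. (x i - x' i) * y i)})"
    for x x' :: "nat \<Rightarrow> int"
  have fin: "finite E" by (rule finite_subset[OF E finite_zn_vec])
  have k2: "k \<ge> 2" using False k by simp
  \<comment> \<open>The bound is uniform in \<open>x'\<close>, so the outer summation over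
    \<open>x'\<close> costs only a factor \<open>e\<close>.\<close>
  have dev: "(\<Sum>x\<in>E. (N x x' - a)\<^sup>2) \<le> e ^ 3 / real n ^ k" for x'
    unfolding N_def a_def e_def
    by (rule order_trans[OF sum_coincidence_deviation_le[OF n E] D])
  have N_le: "N x x' \<le> e" for x x'
    unfolding N_def e_def using fin by (simp add: card_mono)
  have "(\<Sum>x\<in>E. \<Sum>x'\<in>E. N x x' ^ k) \<le>
      (\<Sum>x\<in>E. \<Sum>x'\<in>E. (2 * a) ^ k + 4 * e ^ (k - 2) * (N x x' - a)\<^sup>2)"
    using k2 N_le
    by (intro sum_mono power_le_double_mean_plus_deviation) (simp_all add: N_def e_def a_def)
  \<comment> \<open>The summations are exchanged because \<open>dev\<close> fixes \<open>x'\<close>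
    and sums over \<open>x\<close>.\<close>
  also have "\<dots> = e * (e * (2 * a) ^ k) + 4 * e ^ (k - 2) * (\<Sum>x'\<in>E. \<Sum>x\<in>E. (N x x' - a)\<^sup>2)"
    unfolding sum.swap[of "\<lambda>x' x. (N x x' - a)\<^sup>2"] sum.distrib sum_distrib_left[symmetric]
    by (simp only: sum_constant e_def)
  also have "\<dots> \<le> e * (e * (2 * a) ^ k) + 4 * e ^ (k - 2) * (\<Sum>x'\<in>E. e ^ 3 / real n ^ k)"
    by (intro add_left_mono mult_left_mono sum_mono dev) (simp add: e_def)
  also have "\<dots> = 2 ^ k * (e ^ (k + 2) / real n ^ k) + 4 * (e ^ (k - 2) * e ^ 4 / real n ^ k)"
  proof -
    have "e * (e * (2 * a) ^ k) = 2 ^ k * (e ^ (k + 2) / real n ^ k)"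
      by (simp add: a_def power_mult_distrib power_divide)
    moreover have "(\<Sum>x'\<in>E. e ^ 3 / real n ^ k) = e ^ 4 / real n ^ k"
      by (simp add: e_def power_Suc[of _ 3, simplified])
    ultimately show ?thesis by (simp only: times_divide_eq_right mult.assoc)
  qed
  also have "e ^ (k - 2) * e ^ 4 = e ^ (k + 2)"
    unfolding power_add[symmetric] using k2 by simp
  also have "2 ^ k * (e ^ (k + 2) / real n ^ k) + 4 * (e ^ (k + 2) / real n ^ k) =
      (2 ^ k + 4) * e ^ (k + 2) / real n ^ k"
    by (simp only: distrib_right times_divide_eq_right add_divide_distrib)
  finally show ?thesis by (simp only: N_def e_def)
qed

section \<open>Conclusion with explicit constants\<close>

theorem theorem5p1:
  fixes d k :: nat
  assumes "d \<ge> 1" and "k \<ge> 1"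
  shows "\<exists>C>(0::real). \<exists>c>(0::real). \<forall>(n::nat) (E :: (nat \<Rightarrow> int) set).
    n \<ge> 3 \<longrightarrow> odd n \<longrightarrow> E \<subseteq> zn_vec n d \<longrightarrow>
    real (card E) \<ge> C * (sqrt (real (num_divisors n)) * real n powr (real d + (real k - 1) / 2)
                        / real (least_prime_divisor n) powr ((real d - 1) / 2)) \<longrightarrow>
    1 / real (card E) ^ k * (\<Sum>y\<in>{..<k} \<rightarrow>\<^sub>E E. real (card (star_set n d k y E)))
      \<ge> c * real n ^ k"
proof (intro exI conjI allI impI)
  \<comment> \<open>The size hypothesis suffices with constant 1, and the final constant is the
    reciprocal of the one in the collision bound.\<close>
  show "0 < (1::real)" "0 < 1 / (2 ^ k + 4 :: real)" by (simp_all add: add_pos_pos)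
next
  fix n :: nat and E :: "(nat \<Rightarrow> int) set"
  assume n3: "n \<ge> 3" and E: "E \<subseteq> zn_vec n d"
    and large: "real (card E) \<ge> 1 * (sqrt (real (num_divisors n)) *
      real n powr (real d + (real k - 1) / 2) /
      real (least_prime_divisor n) powr ((real d - 1) / 2))"
  define e \<tau> \<gamma> S where "e = real (card E)" and "\<tau> = real (num_divisors n)"
    and "\<gamma> = real (least_prime_divisor n)"
    and "S = (\<Sum>y\<in>{..<k} \<rightarrow>\<^sub>E E. real (card (star_set n d k y E)))"
  define D where "D = (\<Sum>z\<in>zn_vec n d. dot_discrepancy n d E z)"
  define K where "K = (2 ^ k + 4 :: real)"
  have n: "n > 0" "n > 1" using n3 by auto
  have fin: "finite E" by (rule finite_subset[OF E finite_zn_vec])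
  have \<gamma>: "\<gamma> > 0"
    using prime_least_prime_divisor[OF n(2)] by (simp add: \<gamma>_def prime_gt_0_nat)
  have "1 \<in> {m. m dvd n}" and "finite {m. m dvd n}" using n by auto
  then have \<tau>: "\<tau> > 0" unfolding \<tau>_def num_divisors_def of_nat_0_less_iff card_gt_0_iff by blast
  \<comment> \<open>\<open>R\<close> is the size threshold. Its square has natural exponents only,
    so the rest of the argument avoids \<open>powr\<close>.\<close>
  define R where "R = sqrt \<tau> * real n powr (real d + (real k - 1) / 2) / \<gamma> powr ((real d - 1) / 2)"
  have R: "R > 0" using \<tau> \<gamma> n by (simp add: R_def)
  have eR: "e \<ge> R" using large by (simp add: e_def R_def \<tau>_def \<gamma>_def)
  then have e: "e > 0" using R by linarith
  have sq: "(x powr b)\<^sup>2 = x ^ m" if "x > 0" "2 * b = real m" for x b :: real and m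
    using that by (simp add: power2_eq_square powr_realpow flip: powr_add)
  have "(real n powr (real d + (real k - 1) / 2))\<^sup>2 = real n ^ (2 * d + k - 1)"
    using n assms by (intro sq) (auto simp: of_nat_diff field_simps)
  moreover have "(\<gamma> powr ((real d - 1) / 2))\<^sup>2 = \<gamma> ^ (d - 1)"
    using \<gamma> assms by (intro sq) (auto simp: of_nat_diff field_simps)
  ultimately have "R\<^sup>2 = \<tau> * real n ^ (2 * d + k - 1) / \<gamma> ^ (d - 1)"
    using \<tau> by (simp add: R_def power_mult_distrib power_divide)
  moreover have "R\<^sup>2 \<le> e\<^sup>2" using eR R by (intro power_mono) auto
  ultimately have large2: "\<tau> * real n ^ (2 * d + k - 1) / \<gamma> ^ (d - 1) \<le> e\<^sup>2" by simp

  have "real n * D \<le> real n ^ d * e * (real n * \<tau> * (real n / \<gamma>) ^ (d - 1))"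
    unfolding D_def e_def \<tau>_def \<gamma>_def
    using sum_dot_discrepancy_le[OF n(1) E]
      mult_left_mono[OF sum_gcd_power_le[OF n(2) assms(1)], of "real n ^ d * real (card E)"]
    by (simp add: mult.assoc)
  then have "D \<le> real n ^ d * e * (\<tau> * (real n / \<gamma>) ^ (d - 1))"
    using n by (simp add: mult_ac)
  \<comment> \<open>Multiplying by n^k turns the powers of \<open>n\<close> into n^(2d+k-1), exactly
    the power in the squared threshold; one factor \<open>e\<close> of the variance bound remains
    and gives \<open>e ^ 3\<close>.\<close>
  then have "D * real n ^ k \<le> real n ^ d * e * (\<tau> * (real n / \<gamma>) ^ (d - 1)) * real n ^ k"
    by (intro mult_right_mono) auto
  also have "\<dots> = e * (\<tau> * (real n ^ d * real n ^ (d - 1) * real n ^ k) / \<gamma> ^ (d - 1))"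
    by (simp add: power_divide mult_ac)
  also have "real n ^ d * real n ^ (d - 1) * real n ^ k = real n ^ (2 * d + k - 1)"
    using assms by (simp flip: power_add) (simp add: mult_2)
  also have "e * (\<tau> * real n ^ (2 * d + k - 1) / \<gamma> ^ (d - 1)) \<le> e * e\<^sup>2"
    using e large2 by (intro mult_left_mono) auto
  finally have "D * real n ^ k \<le> e ^ 3" by (simp add: power3_eq_cube power2_eq_square)
  then have "D \<le> e ^ 3 / real n ^ k" using n by (simp add: field_simps)
  note M = collisions_le[OF n(1) E assms(2) this[unfolded D_def e_def]]
  have "S \<ge> 0" by (simp add: S_def sum_nonneg)
  \<comment> \<open>Both sides carry a factor \<open>e ^ (k + 2)\<close>; cancelling it leaves the
    normalisation \<open>e ^ k\<close> of the average over \<open>y\<close>.\<close>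
  then have "(e ^ (k + 1))\<^sup>2 \<le> S * (K * e ^ (k + 2) / real n ^ k)"
    using order_trans[OF card_power_le_star_sets_mult_collisions[OF n(2) fin, of k d]
      mult_left_mono[OF M]]
    unfolding S_def e_def K_def by simp
  moreover have "(e ^ (k + 1))\<^sup>2 = e ^ k * e ^ (k + 2)"
    by (simp add: power2_eq_square flip: power_add)
  ultimately have "e ^ k * e ^ (k + 2) \<le> S * K * e ^ (k + 2) / real n ^ k"
    by (simp only: times_divide_eq_right mult.assoc)
  then have "e ^ k * e ^ (k + 2) * real n ^ k \<le> S * K * e ^ (k + 2)"
    using n by (subst (asm) pos_le_divide_eq) simp_all
  then have "(e ^ k * real n ^ k) * e ^ (k + 2) \<le> (S * K) * e ^ (k + 2)"
    by (simp only: mult.assoc mult.commute mult.left_commute)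
  then have "e ^ k * real n ^ k \<le> S * K" using e by (simp only: mult_le_cancel_right_pos zero_less_power)
  moreover have "K > 0" by (simp add: K_def add_pos_pos)
  ultimately have "real n ^ k / K \<le> S / e ^ k"
    using e by (simp add: pos_divide_le_eq pos_le_divide_eq mult_ac)
  then have "1 / K * real n ^ k \<le> 1 / e ^ k * S" by simp
  then show "1 / real (card E) ^ k * (\<Sum>y\<in>{..<k} \<rightarrow>\<^sub>E E. real (card (star_set n d k y E)))
      \<ge> 1 / (2 ^ k + 4) * real n ^ k"
    by (simp only: S_def e_def K_def)
qed

end
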